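(* Let $\beta\ge2$ be an integer, $p_0,\dots,p_{\beta-1}>0$ with $p_0+\dots+p_{\beta-1}=1$, let $S$ be the one-sided full $\beta$-shift on $\Sigma_+=\{0,\dots,\beta-1\}^{\mathbb{N}}$ with the Bernoulli measure $\mu_+$ of weights $(p_i)$, and let $V_S$ be its Perron-Frobenius operator on $L^2(\Sigma_+,\mu_+)$. Let $X=\mathbb{C}[h]$ with $h$ as in the context. For any $f\in X$, $$V_S^kf\to\int_{\Sigma_+}f\,d\mu_+\cdot\Phi_0\quad\text{in }X\text{ as }k\to\infty,$$ where $\Phi_0\equiv1$.
   Context: $\Sigma_+$ has elements $\omega=(\omega_1,\omega_2,\dots)$; $(S\omega)_j=\omega_{j+1}$; $\mu_+=\mu_0^{\otimes\mathbb{N}}$ with $\mu_0(\{i\})=p_i$. The Koopman operator on $L^2(\Sigma_+,\mu_+)$ is $(U_Sf)(\omega)=f(S\omega)$ and $V_S=U_S^*$. For $n\ge1$ let $N_n^k(\omega)=\#\{i\in\{1,\dots,n-1\}:\omega_i=k\}$ (so $N_1^k=0$), and $$h(\omega)=\sum_{n\ge1,\ \omega_n\ne0}(p_0+\dots+p_{\omega_n-1})\,p_0^{N_n^0(\omega)}\cdots p_{\beta-1}^{N_n^{\beta-1}(\omega)}.$$ $X=\varinjlim X_n$, $X_n=\sum_{i=0}^n\mathbb{C}h^i$ (finite-dimensional with usual topology), with the inductive limit topology; $V_S$ maps each $X_n$ into itself. *)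

theory Defs
  imports "HOL-Probability.Probability"
begin

section \<open>The Hilbert space \<open>L\<^sup>2(M)\<close> of classes of square-integrable functions\<close>

definition sq_integrable :: "'a measure \<Rightarrow> ('a \<Rightarrow> complex) set" where
  "sq_integrable M =
     {f. f \<in> borel_measurable M \<and> integrable M (\<lambda>x. (cmod (f x))\<^sup>2)}"

definition l2_rel :: "'a measure \<Rightarrow> (('a \<Rightarrow> complex) \<times> ('a \<Rightarrow> complex)) set" where
  "l2_rel M = {(f, g). f \<in> sq_integrable M \<and> g \<in> sq_integrable M \<and> (AE x in M. f x = g x)}"

lemma equiv_l2_rel: "equiv (sq_integrable M) (l2_rel M)"
proof (rule equivI)
  show "l2_rel M \<subseteq> sq_integrable M \<times> sq_integrable M"
    by (auto simp: l2_rel_def)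
  show "refl_on (sq_integrable M) (l2_rel M)"
    by (auto simp: refl_on_def l2_rel_def)
  show "sym (l2_rel M)"
    by (simp add: sym_def l2_rel_def eq_commute)
  show "trans (l2_rel M)"
  proof (rule transI)
    fix f g k assume fg: "(f, g) \<in> l2_rel M" and gk: "(g, k) \<in> l2_rel M"
    then have "AE x in M. f x = g x" "AE x in M. g x = k x"
      by (simp_all add: l2_rel_def)
    then have "AE x in M. f x = k x" by eventually_elim simp
    with fg gk show "(f, k) \<in> l2_rel M" by (simp add: l2_rel_def)
  qed
qed

definition L2_space :: "'a measure \<Rightarrow> ('a \<Rightarrow> complex) set set" where
  "L2_space M = sq_integrable M // l2_rel M"

definition l2_class :: "'a measure \<Rightarrow> ('a \<Rightarrow> complex) \<Rightarrow> ('a \<Rightarrow> complex) set" where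
  "l2_class M f = l2_rel M `` {f}"

definition l2_rep :: "('a \<Rightarrow> complex) set \<Rightarrow> 'a \<Rightarrow> complex" where
  "l2_rep F = (SOME f. f \<in> F)"

definition l2_add ::
    "'a measure \<Rightarrow> ('a \<Rightarrow> complex) set \<Rightarrow> ('a \<Rightarrow> complex) set \<Rightarrow> ('a \<Rightarrow> complex) set" where
  "l2_add M F G = l2_class M (\<lambda>x. l2_rep F x + l2_rep G x)"

definition l2_scale ::
    "'a measure \<Rightarrow> complex \<Rightarrow> ('a \<Rightarrow> complex) set \<Rightarrow> ('a \<Rightarrow> complex) set" where
  "l2_scale M c F = l2_class M (\<lambda>x. c * l2_rep F x)"

definition l2_inner ::
    "'a measure \<Rightarrow> ('a \<Rightarrow> complex) set \<Rightarrow> ('a \<Rightarrow> complex) set \<Rightarrow> complex" where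
  "l2_inner M F G = (\<integral>x. l2_rep F x * cnj (l2_rep G x) \<partial>M)"

definition l2_norm :: "'a measure \<Rightarrow> ('a \<Rightarrow> complex) set \<Rightarrow> real" where
  "l2_norm M F = sqrt (\<integral>x. (cmod (l2_rep F x))\<^sup>2 \<partial>M)"

definition l2_integral :: "'a measure \<Rightarrow> ('a \<Rightarrow> complex) set \<Rightarrow> complex" where
  "l2_integral M F = (\<integral>x. l2_rep F x \<partial>M)"

definition l2_adjoint ::
    "'a measure \<Rightarrow> (('a \<Rightarrow> complex) set \<Rightarrow> ('a \<Rightarrow> complex) set) \<Rightarrow>
     ('a \<Rightarrow> complex) set \<Rightarrow> ('a \<Rightarrow> complex) set" where
  "l2_adjoint M U G =
     (THE K. K \<in> L2_space M \<and> (\<forall>F\<in>L2_space M. l2_inner M (U F) G = l2_inner M F K))"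

definition koopman ::
    "'a measure \<Rightarrow> ('a \<Rightarrow> 'a) \<Rightarrow> ('a \<Rightarrow> complex) set \<Rightarrow> ('a \<Rightarrow> complex) set" where
  "koopman M T F = l2_class M (\<lambda>x. l2_rep F (T x))"

definition perron_frobenius ::
    "'a measure \<Rightarrow> ('a \<Rightarrow> 'a) \<Rightarrow> ('a \<Rightarrow> complex) set \<Rightarrow> ('a \<Rightarrow> complex) set" where
  "perron_frobenius M T = l2_adjoint M (koopman M T)"


section \<open>Inductive limits of finite-dimensional subspaces of \<open>L\<^sup>2(M)\<close>\<close>

definition l2_abs_convex :: "'a measure \<Rightarrow> ('a \<Rightarrow> complex) set set \<Rightarrow> bool" where
  "l2_abs_convex M W \<longleftrightarrow>
     (\<forall>F\<in>W. \<forall>G\<in>W. \<forall>a b. cmod a + cmod b \<le> 1 \<longrightarrow>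
        l2_add M (l2_scale M a F) (l2_scale M b G) \<in> W)"

text \<open>
  The basic neighbourhoods of zero of the locally convex inductive limit of the spaces
  \<open>Y n\<close>: absolutely convex sets whose trace on each \<open>Y n\<close> is a neighbourhood of zero
  in \<open>Y n\<close>.  The \<open>Y n\<close> are meant to be an increasing sequence of finite-dimensional
  subspaces of \<open>L\<^sup>2(M)\<close>; the usual topology of \<open>Y n\<close> is then the one given by
  (any norm, in particular) the \<open>L\<^sup>2\<close>-norm.
\<close>

definition ind_limit_nhd0 ::
    "'a measure \<Rightarrow> (nat \<Rightarrow> ('a \<Rightarrow> complex) set set) \<Rightarrow> ('a \<Rightarrow> complex) set set \<Rightarrow> bool" where
  "ind_limit_nhd0 M Y W \<longleftrightarrow>
     W \<subseteq> (\<Union>n. Y n) \<and> l2_abs_convex M W \<and>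
     (\<forall>n. \<exists>\<epsilon>>0. \<forall>F\<in>Y n. l2_norm M F < \<epsilon> \<longrightarrow> F \<in> W)"

definition ind_limit_open ::
    "'a measure \<Rightarrow> (nat \<Rightarrow> ('a \<Rightarrow> complex) set set) \<Rightarrow> ('a \<Rightarrow> complex) set set \<Rightarrow> bool" where
  "ind_limit_open M Y U \<longleftrightarrow>
     U \<subseteq> (\<Union>n. Y n) \<and>
     (\<forall>F\<in>U. \<exists>W. ind_limit_nhd0 M Y W \<and> (\<forall>G\<in>W. l2_add M F G \<in> U))"

definition ind_limit_topology ::
    "'a measure \<Rightarrow> (nat \<Rightarrow> ('a \<Rightarrow> complex) set set) \<Rightarrow> ('a \<Rightarrow> complex) set topology" where
  "ind_limit_topology M Y = topology (ind_limit_open M Y)"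

lemma ind_limit_nhd0_Int:
  assumes "ind_limit_nhd0 M Y V" and "ind_limit_nhd0 M Y W"
  shows "ind_limit_nhd0 M Y (V \<inter> W)"
proof -
  have "\<exists>\<epsilon>>0. \<forall>F\<in>Y n. l2_norm M F < \<epsilon> \<longrightarrow> F \<in> V \<inter> W" for n
  proof -
    obtain d e where "d > 0" "\<forall>F\<in>Y n. l2_norm M F < d \<longrightarrow> F \<in> V"
      and "e > 0" "\<forall>F\<in>Y n. l2_norm M F < e \<longrightarrow> F \<in> W"
      using assms unfolding ind_limit_nhd0_def by meson
    then show ?thesis by (intro exI[of _ "min d e"]) auto
  qed
  moreover have "l2_abs_convex M (V \<inter> W)" "V \<inter> W \<subseteq> (\<Union>n. Y n)"
    using assms by (auto simp: ind_limit_nhd0_def l2_abs_convex_def)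
  ultimately show ?thesis by (simp add: ind_limit_nhd0_def)
qed

lemma ind_limit_openE:
  assumes "ind_limit_open M Y U" and "F \<in> U"
  obtains W where "ind_limit_nhd0 M Y W" "\<forall>G\<in>W. l2_add M F G \<in> U"
  using assms unfolding ind_limit_open_def by auto

lemma istopology_ind_limit_open: "istopology (ind_limit_open M Y)"
  unfolding istopology_def
proof (intro conjI allI impI)
  fix S T assume S: "ind_limit_open M Y S" and T: "ind_limit_open M Y T"
  have "\<exists>W. ind_limit_nhd0 M Y W \<and> (\<forall>G\<in>W. l2_add M F G \<in> S \<inter> T)" if "F \<in> S \<inter> T" for F
  proof -
    from that have "F \<in> S" "F \<in> T" by auto
    obtain V where V: "ind_limit_nhd0 M Y V" "\<forall>G\<in>V. l2_add M F G \<in> S"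
      using S \<open>F \<in> S\<close> by (rule ind_limit_openE)
    obtain W where W: "ind_limit_nhd0 M Y W" "\<forall>G\<in>W. l2_add M F G \<in> T"
      using T \<open>F \<in> T\<close> by (rule ind_limit_openE)
    show ?thesis
      using ind_limit_nhd0_Int[OF V(1) W(1)] V(2) W(2) by (intro exI[of _ "V \<inter> W"]) simp
  qed
  then show "ind_limit_open M Y (S \<inter> T)"
    using S unfolding ind_limit_open_def by (simp add: le_infI1)
next
  fix K assume K: "\<forall>S\<in>K. ind_limit_open M Y S"
  show "ind_limit_open M Y (\<Union>K)"
    unfolding ind_limit_open_def
  proof (intro conjI ballI)
    show "\<Union>K \<subseteq> (\<Union>n. Y n)"
      using K by (intro Union_least) (simp add: ind_limit_open_def)
  next
    fix F assume "F \<in> \<Union>K"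
    then obtain S where "S \<in> K" "F \<in> S" by blast
    then have "ind_limit_open M Y S" using K by simp
    then obtain W where "ind_limit_nhd0 M Y W" "\<forall>G\<in>W. l2_add M F G \<in> S"
      using \<open>F \<in> S\<close> by (rule ind_limit_openE)
    with \<open>S \<in> K\<close> show "\<exists>W. ind_limit_nhd0 M Y W \<and> (\<forall>G\<in>W. l2_add M F G \<in> \<Union>K)" by blast
  qed
qed

lemma openin_ind_limit_topology: "openin (ind_limit_topology M Y) = ind_limit_open M Y"
  unfolding ind_limit_topology_def by (rule topology_inverse'[OF istopology_ind_limit_open])


section \<open>The one-sided Bernoulli shift\<close>

text \<open>
  Sequences are indexed from 0: the coordinate \<open>\<omega>\<^sub>n\<close> (\<open>n \<ge> 1\<close>) of the usual notation is
  \<open>\<omega> (n - 1)\<close> here.  The underlying space of \<open>bernoulli_measure \<beta> p\<close> is the set of all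
  sequences with values in \<open>{..<\<beta>}\<close>.
\<close>

definition bernoulli_measure :: "nat \<Rightarrow> (nat \<Rightarrow> real) \<Rightarrow> (nat \<Rightarrow> nat) measure" where
  "bernoulli_measure \<beta> p = (\<Pi>\<^sub>M _\<in>UNIV. point_measure {..<\<beta>} (\<lambda>i. ennreal (p i)))"

definition seq_shift :: "(nat \<Rightarrow> nat) \<Rightarrow> nat \<Rightarrow> nat" where
  "seq_shift \<omega> = (\<lambda>j. \<omega> (Suc j))"

definition digit_count :: "(nat \<Rightarrow> nat) \<Rightarrow> nat \<Rightarrow> nat \<Rightarrow> nat" where
  "digit_count \<omega> n k = card {i. i < n \<and> \<omega> i = k}"

definition h_fun :: "nat \<Rightarrow> (nat \<Rightarrow> real) \<Rightarrow> (nat \<Rightarrow> nat) \<Rightarrow> real" where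
  "h_fun \<beta> p \<omega> =
     (\<Sum>n. if \<omega> n \<noteq> 0 then (\<Sum>j<\<omega> n. p j) * (\<Prod>k<\<beta>. p k ^ digit_count \<omega> n k) else 0)"

definition h_poly_deg :: "nat \<Rightarrow> (nat \<Rightarrow> real) \<Rightarrow> nat \<Rightarrow> ((nat \<Rightarrow> nat) \<Rightarrow> complex) set set" where
  "h_poly_deg \<beta> p n =
     {l2_class (bernoulli_measure \<beta> p) (\<lambda>\<omega>. \<Sum>i\<le>n. c i * complex_of_real (h_fun \<beta> p \<omega>) ^ i)
       | c :: nat \<Rightarrow> complex. True}"

definition h_poly :: "nat \<Rightarrow> (nat \<Rightarrow> real) \<Rightarrow> ((nat \<Rightarrow> nat) \<Rightarrow> complex) set set" where
  "h_poly \<beta> p = (\<Union>n. h_poly_deg \<beta> p n)"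

definition h_poly_topology ::
    "nat \<Rightarrow> (nat \<Rightarrow> real) \<Rightarrow> ((nat \<Rightarrow> nat) \<Rightarrow> complex) set topology" where
  "h_poly_topology \<beta> p = ind_limit_topology (bernoulli_measure \<beta> p) (h_poly_deg \<beta> p)"

end

(*
  Splitting off the first digit gives h(i \<omega>) = P_i + p_i h(\<omega>) with P_i = p_0 + ... + p_{i-1}, so V_S
  maps q(h) to (T q)(h) with (T q)(x) = \<Sum>i. p_i q(P_i + p_i x), and T does not raise the degree.
  Since h takes values in [0,1], which the maps x -> P_i + p_i x preserve, T multiplies the Lipschitz
  constant of a polynomial on [0,1] by at most \<Sum>i. p_i^2 < 1.  The integral of (T^k q)(h) does not
  depend on k, so (T^k q)(h) converges uniformly to it, inside one finite-dimensional space X_n.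
*)

theory Submission
  imports Defs "HOL-Computational_Algebra.Polynomial"
begin

section \<open>Representatives of \<open>L\<^sup>2\<close> classes\<close>

lemma sq_integrable_add:
  assumes "f \<in> sq_integrable M" "g \<in> sq_integrable M"
  shows "(\<lambda>x. f x + g x) \<in> sq_integrable M"
proof -
  have [measurable]: "f \<in> borel_measurable M" "g \<in> borel_measurable M"
    using assms by (auto simp: sq_integrable_def)
  have "integrable M (\<lambda>x. 2 * (cmod (f x))\<^sup>2 + 2 * (cmod (g x))\<^sup>2)"
    using assms by (auto simp: sq_integrable_def)
  moreover have "(cmod (f x + g x))\<^sup>2 \<le> 2 * (cmod (f x))\<^sup>2 + 2 * (cmod (g x))\<^sup>2" for x
  proof -
    have "(cmod (f x + g x))\<^sup>2 \<le> (cmod (f x) + cmod (g x))\<^sup>2"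
      by (intro power_mono norm_triangle_ineq) simp
    also have "\<dots> \<le> 2 * (cmod (f x))\<^sup>2 + 2 * (cmod (g x))\<^sup>2"
      using zero_le_power2[of "cmod (f x) - cmod (g x)"]
      by (simp add: power2_sum power2_diff)
    finally show ?thesis .
  qed
  ultimately have "integrable M (\<lambda>x. (cmod (f x + g x))\<^sup>2)"
    by (elim Bochner_Integration.integrable_bound) auto
  then show ?thesis
    by (simp add: sq_integrable_def)
qed

lemma sq_integrable_scale:
  "f \<in> sq_integrable M \<Longrightarrow> (\<lambda>x. c * f x) \<in> sq_integrable M"
  by (auto simp: sq_integrable_def norm_mult power_mult_distrib)

lemma sq_integrable_imp_integrable_mult_cnj:
  assumes "f \<in> sq_integrable M" "g \<in> sq_integrable M"
  shows "integrable M (\<lambda>x. f x * cnj (g x))"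
proof -
  have [measurable]: "f \<in> borel_measurable M" "g \<in> borel_measurable M"
    using assms by (auto simp: sq_integrable_def)
  have m: "(\<lambda>x. f x * cnj (g x)) \<in> borel_measurable M"
    by (intro borel_measurable_times measurable_compose[OF _ borel_measurable_continuous_onI[of cnj]]
        continuous_intros) auto
  have "integrable M (\<lambda>x. (cmod (f x))\<^sup>2 + (cmod (g x))\<^sup>2)"
    using assms by (auto simp: sq_integrable_def)
  moreover have "cmod (f x * cnj (g x)) \<le> (cmod (f x))\<^sup>2 + (cmod (g x))\<^sup>2" for x
  proof -
    have "cmod (f x) * cmod (g x) \<le> (cmod (f x))\<^sup>2 + (cmod (g x))\<^sup>2"
      using sum_squares_bound[of "cmod (f x)" "cmod (g x)"]
        mult_nonneg_nonneg[OF norm_ge_zero[of "f x"] norm_ge_zero[of "g x"]] by linarith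
    then show ?thesis by (simp add: norm_mult)
  qed
  ultimately show ?thesis
    using m by (elim Bochner_Integration.integrable_bound) auto
qed

section \<open>Passing between functions and their classes\<close>

lemma l2_class_in_L2_space: "f \<in> sq_integrable M \<Longrightarrow> l2_class M f \<in> L2_space M"
  by (simp add: l2_class_def L2_space_def quotientI)

lemma l2_class_eqI:
  assumes "f \<in> sq_integrable M" "g \<in> sq_integrable M" "AE x in M. f x = g x"
  shows "l2_class M f = l2_class M g"
  unfolding l2_class_def using assms
  by (intro equiv_class_eq[OF equiv_l2_rel]) (simp add: l2_rel_def)

text \<open>A class contains the function that generates it, so the choice in \<open>l2_rep\<close>
  picks some almost everywhere equal function. All operations on classes are defined through
  \<open>l2_rep\<close>; this is what lets them be computed on any given function.\<close>

lemma l2_rep_class: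
  assumes "f \<in> sq_integrable M"
  shows "l2_rep (l2_class M f) \<in> sq_integrable M" and "AE x in M. l2_rep (l2_class M f) x = f x"
proof -
  have "f \<in> l2_class M f"
    using assms by (simp add: l2_class_def l2_rel_def)
  then have "l2_rep (l2_class M f) \<in> l2_class M f"
    unfolding l2_rep_def by (rule someI[of "\<lambda>g. g \<in> l2_class M f"])
  then show "l2_rep (l2_class M f) \<in> sq_integrable M" "AE x in M. l2_rep (l2_class M f) x = f x"
    by (auto simp: l2_class_def l2_rel_def eq_commute)
qed

lemma L2_spaceE:
  assumes "F \<in> L2_space M"
  obtains f where "f \<in> sq_integrable M" "F = l2_class M f"
  using assms by (auto simp: L2_space_def l2_class_def elim: quotientE)

lemma l2_add_class:
  assumes "f \<in> sq_integrable M" "g \<in> sq_integrable M"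
  shows "l2_add M (l2_class M f) (l2_class M g) = l2_class M (\<lambda>x. f x + g x)"
  unfolding l2_add_def
proof (rule l2_class_eqI)
  show "AE x in M. l2_rep (l2_class M f) x + l2_rep (l2_class M g) x = f x + g x"
    using l2_rep_class(2)[OF assms(1)] l2_rep_class(2)[OF assms(2)] by eventually_elim simp
qed (use assms in \<open>auto intro!: sq_integrable_add l2_rep_class\<close>)

lemma l2_scale_class:
  assumes "f \<in> sq_integrable M"
  shows "l2_scale M c (l2_class M f) = l2_class M (\<lambda>x. c * f x)"
  unfolding l2_scale_def
proof (rule l2_class_eqI)
  show "AE x in M. c * l2_rep (l2_class M f) x = c * f x"
    using l2_rep_class(2)[OF assms(1)] by eventually_elim simp
qed (use assms in \<open>auto intro!: sq_integrable_scale l2_rep_class\<close>)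

lemma l2_rep_class_measurable:
  assumes "f \<in> sq_integrable M"
  shows "l2_rep (l2_class M f) \<in> borel_measurable M" "f \<in> borel_measurable M"
  using assms l2_rep_class(1)[OF assms] by (auto simp: sq_integrable_def)

lemma l2_norm_class:
  assumes "f \<in> sq_integrable M"
  shows "l2_norm M (l2_class M f) = sqrt (\<integral>x. (cmod (f x))\<^sup>2 \<partial>M)"
proof -
  note [measurable] = l2_rep_class_measurable[OF assms]
  have "(\<integral>x. (cmod (l2_rep (l2_class M f) x))\<^sup>2 \<partial>M) = (\<integral>x. (cmod (f x))\<^sup>2 \<partial>M)"
    using l2_rep_class(2)[OF assms] by (intro integral_cong_AE) auto
  then show ?thesis by (simp add: l2_norm_def)
qed

lemma l2_integral_class:
  assumes "f \<in> sq_integrable M"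
  shows "l2_integral M (l2_class M f) = (\<integral>x. f x \<partial>M)"
  unfolding l2_integral_def
  using l2_rep_class(2)[OF assms] l2_rep_class_measurable[OF assms] by (intro integral_cong_AE)

lemma l2_inner_class:
  assumes "f \<in> sq_integrable M" "g \<in> sq_integrable M"
  shows "l2_inner M (l2_class M f) (l2_class M g) = (\<integral>x. f x * cnj (g x) \<partial>M)"
  unfolding l2_inner_def
proof (rule integral_cong_AE)
  show "AE x in M. l2_rep (l2_class M f) x * cnj (l2_rep (l2_class M g) x) = f x * cnj (g x)"
    using l2_rep_class(2)[OF assms(1)] l2_rep_class(2)[OF assms(2)] by eventually_elim simp
qed (use assms in \<open>auto intro!: borel_measurable_integrable sq_integrable_imp_integrable_mult_cnj l2_rep_class\<close>)

text \<open>Testing against the difference \<open>d\<close> of the two functions gives zero for the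
  integral of \<open>|d|^2\<close>. This yields the uniqueness behind the definite description in
  \<open>l2_adjoint\<close>.\<close>

lemma l2_class_eq_of_inner_eq:
  assumes f: "f \<in> sq_integrable M" and g: "g \<in> sq_integrable M"
    and inner: "\<And>F. F \<in> L2_space M \<Longrightarrow> l2_inner M F (l2_class M f) = l2_inner M F (l2_class M g)"
  shows "l2_class M f = l2_class M g"
proof -
  define d where "d = (\<lambda>x. f x + (-1) * g x)"
  have d: "d \<in> sq_integrable M"
    unfolding d_def by (intro sq_integrable_add sq_integrable_scale f g)
  note int = sq_integrable_imp_integrable_mult_cnj[OF d]
  have "(\<integral>x. d x * cnj (f x) \<partial>M) = (\<integral>x. d x * cnj (g x) \<partial>M)"
    using inner[OF l2_class_in_L2_space[OF d]] by (simp add: l2_inner_class d f g)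
  then have "(\<integral>x. d x * cnj (f x) - d x * cnj (g x) \<partial>M) = 0"
    using int[OF f] int[OF g] by simp
  moreover have "d x * cnj (f x) - d x * cnj (g x) = complex_of_real ((cmod (d x))\<^sup>2)" for x
    by (subst complex_norm_square) (simp add: d_def algebra_simps)
  ultimately have "(\<integral>x. (cmod (d x))\<^sup>2 \<partial>M) = 0"
    by (metis (no_types, lifting) Bochner_Integration.integral_cong integral_complex_of_real of_real_eq_0_iff)
  moreover have "integrable M (\<lambda>x. (cmod (d x))\<^sup>2)"
    using d by (simp add: sq_integrable_def)
  ultimately have "AE x in M. (cmod (d x))\<^sup>2 = 0"
    using integral_nonneg_eq_0_iff_AE[of M "\<lambda>x. (cmod (d x))\<^sup>2"] by simp
  then have "AE x in M. f x = g x"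
    by eventually_elim (simp add: d_def)
  then show ?thesis by (intro l2_class_eqI f g)
qed

text \<open>Reduces the computation of an adjoint at \<open>G\<close> to exhibiting one class with
  the right inner products.\<close>

lemma l2_adjoint_eqI:
  assumes K: "K \<in> L2_space M"
    and inner: "\<And>F. F \<in> L2_space M \<Longrightarrow> l2_inner M (U F) G = l2_inner M F K"
  shows "l2_adjoint M U G = K"
  unfolding l2_adjoint_def
proof (rule the_equality)
  show "K \<in> L2_space M \<and> (\<forall>F\<in>L2_space M. l2_inner M (U F) G = l2_inner M F K)"
    using assms by blast
next
  fix K' assume K': "K' \<in> L2_space M \<and> (\<forall>F\<in>L2_space M. l2_inner M (U F) G = l2_inner M F K')"
  obtain f g where "f \<in> sq_integrable M" "K' = l2_class M f" "g \<in> sq_integrable M" "K = l2_class M g"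
    using K K' by (metis L2_spaceE)
  then show "K' = K"
    using l2_class_eq_of_inner_eq[of f M g] K' inner by auto
qed

section \<open>The transfer operator on polynomials\<close>

text \<open>For positive weights of sum 1 the images of [0,1] under \<open>x -> P_i + p_i x\<close>,
  with \<open>P_i = p_0 + ... + p_{i-1}\<close>, tile [0,1]. This is then the transfer operator, for
  Lebesgue measure, of the piecewise linear map with these inverse branches.\<close>

definition transfer_poly :: "nat \<Rightarrow> (nat \<Rightarrow> real) \<Rightarrow> complex poly \<Rightarrow> complex poly" where
  "transfer_poly \<beta> p q =
     (\<Sum>i<\<beta>. smult (of_real (p i)) (q \<circ>\<^sub>p [:of_real (\<Sum>j<i. p j), of_real (p i):]))"

lemma poly_transfer_poly:
  "poly (transfer_poly \<beta> p q) (of_real x) =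
     (\<Sum>i<\<beta>. of_real (p i) * poly q (of_real ((\<Sum>j<i. p j) + p i * x)))"
  by (simp add: transfer_poly_def poly_sum poly_pcompose mult.commute)

lemma degree_transfer_poly_le: "degree (transfer_poly \<beta> p q) \<le> degree q"
  unfolding transfer_poly_def
proof (rule degree_sum_le)
  fix i
  \<comment> \<open>The factor 1 bounds the degree of the inner polynomial, which is 0 if
    \<open>p i\<close> vanishes; positivity is not assumed here.\<close>
  have "degree (q \<circ>\<^sub>p [:of_real (\<Sum>j<i. p j), of_real (p i):]) \<le> degree q * 1"
    by (intro order.trans[OF degree_pcompose_le] mult_left_mono) auto
  then show "degree (smult (of_real (p i)) (q \<circ>\<^sub>p [:of_real (\<Sum>j<i. p j), of_real (p i):])) \<le> degree q"
    using degree_smult_le[of "of_real (p i)"] by (metis mult.right_neutral order.trans)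
qed simp

lemma degree_funpow_transfer_poly_le: "degree ((transfer_poly \<beta> p ^^ k) q) \<le> degree q"
  by (induction k) (auto intro: order.trans[OF degree_transfer_poly_le])

section \<open>Sup and Lipschitz bounds for polynomials on [0,1]\<close>

lemma poly_bounded_unit_interval:
  fixes q :: "complex poly"
  shows "\<exists>B\<ge>0. \<forall>x\<in>{0..1}. cmod (poly q (of_real x)) \<le> B"
proof -
  have "compact ((\<lambda>x. poly q (of_real x)) ` {0..1::real})"
    by (intro compact_continuous_image continuous_intros) auto
  then obtain B where "\<forall>y \<in> (\<lambda>x. poly q (of_real x)) ` {0..1::real}. cmod y \<le> B"
    using compact_imp_bounded bounded_iff by metis
  then show ?thesis by (intro exI[of _ "max B 0"]) (auto simp: le_max_iff_disj)
qed

text \<open>Induction along the Horner form \<open>a + x q(x)\<close>: the product rule adds to the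
  constant of \<open>q\<close> a bound of \<open>q\<close> on [0,1].\<close>

lemma poly_lipschitz_unit_interval:
  fixes q :: "complex poly"
  shows "\<exists>L\<ge>0. L-lipschitz_on {0..1::real} (\<lambda>x. poly q (of_real x))"
proof (induction q)
  case 0
  show ?case by (intro exI[of _ 0]) (simp add: lipschitz_on_def)
next
  case (pCons a q)
  then obtain L where L: "L \<ge> 0" "L-lipschitz_on {0..1::real} (\<lambda>x. poly q (of_real x))" by blast
  obtain B where B: "B \<ge> 0" "\<And>x. x \<in> {0..1::real} \<Longrightarrow> cmod (poly q (of_real x)) \<le> B"
    using poly_bounded_unit_interval[of q] by auto
  have "(L + B)-lipschitz_on {0..1::real} (\<lambda>x. poly (pCons a q) (of_real x))"
  proof (rule lipschitz_onI)
    fix x y :: real assume x: "x \<in> {0..1}" and y: "y \<in> {0..1}"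
    \<comment> \<open>The constant \<open>a\<close> cancels, and \<open>x q(y)\<close> is inserted
      with both signs.\<close>
    have "dist (poly (pCons a q) (of_real x)) (poly (pCons a q) (of_real y))
        = cmod (of_real x * (poly q (of_real x) - poly q (of_real y)) + of_real (x - y) * poly q (of_real y))"
      by (simp add: dist_norm algebra_simps)
    also have "\<dots> \<le> \<bar>x\<bar> * cmod (poly q (of_real x) - poly q (of_real y)) + \<bar>x - y\<bar> * cmod (poly q (of_real y))"
      by (rule order.trans[OF norm_triangle_ineq]) (simp add: norm_mult flip: of_real_diff)
    also have "\<dots> \<le> 1 * (L * \<bar>x - y\<bar>) + \<bar>x - y\<bar> * B"
      using x y B L(1) lipschitz_onD[OF L(2) x y]
      by (intro add_mono mult_mono) (auto simp: dist_norm dist_real_def)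
    also have "\<dots> = (L + B) * dist x y" by (simp add: dist_real_def algebra_simps)
    finally show "dist (poly (pCons a q) (of_real x)) (poly (pCons a q) (of_real y)) \<le> (L + B) * dist x y" .
  qed (use L B in simp)
  then show ?case using L B by (intro exI[of _ "L + B"]) simp
qed

section \<open>Probability weights and the contraction of Lipschitz constants\<close>

locale probability_weights =
  fixes \<beta> :: nat and p :: "nat \<Rightarrow> real"
  assumes two_le: "\<beta> \<ge> 2" and pos: "\<And>i. i < \<beta> \<Longrightarrow> p i > 0" and sum_one: "(\<Sum>i<\<beta>. p i) = 1"
begin

lemma partial_sum_nonneg: "i < \<beta> \<Longrightarrow> (\<Sum>j<i. p j) \<ge> 0"
  by (intro sum_nonneg) (simp add: less_imp_le pos)

lemma partial_sum_le:
  assumes "i < \<beta>"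
  shows "(\<Sum>j<i. p j) + p i \<le> 1"
proof -
  have "(\<Sum>j<Suc i. p j) \<le> (\<Sum>j<\<beta>. p j)"
    using assms by (intro sum_mono2) (auto simp: less_imp_le pos)
  then show ?thesis by (simp add: sum_one)
qed

text \<open>Since there are at least two digits, some other digit carries positive mass. This makes
  the contraction factor below strictly less than 1.\<close>

lemma weight_less_one:
  assumes "i < \<beta>"
  shows "p i < 1"
proof -
  have "\<exists>j<\<beta>. j \<noteq> i"
    using two_le by (cases "i = 0") (auto intro: exI[of _ 1] exI[of _ 0])
  then obtain j where j: "j < \<beta>" "j \<noteq> i" by blast
  have "p i < (\<Sum>k\<in>{i,j}. p k)" using j pos by simp
  also have "\<dots> \<le> (\<Sum>k<\<beta>. p k)"
    using assms j by (intro sum_mono2) (auto simp: less_imp_le pos)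
  finally show ?thesis by (simp add: sum_one)
qed

lemma sum_squares_less_one: "(\<Sum>i<\<beta>. (p i)\<^sup>2) < 1"
proof -
  have "(\<Sum>i<\<beta>. (p i)\<^sup>2) < (\<Sum>i<\<beta>. p i)"
    using two_le pos weight_less_one
    by (intro sum_strict_mono) (auto simp: power2_eq_square lessThan_empty_iff)
  then show ?thesis by (simp add: sum_one)
qed

lemma affine_unit_interval:
  assumes "i < \<beta>" "x \<in> {0..1}"
  shows "(\<Sum>j<i. p j) + p i * x \<in> {0..1}"
proof -
  have "0 \<le> p i * x" "p i * x \<le> p i"
    using assms pos[of i] by (auto simp: mult_left_le)
  then show ?thesis using partial_sum_nonneg[of i] partial_sum_le[of i] assms by auto
qed

text \<open>Each \<open>p i\<close> enters twice, once as the weight of a branch and once as its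
  slope; hence the squares.\<close>

lemma lipschitz_transfer_poly:
  assumes "L-lipschitz_on {0..1::real} (\<lambda>x. poly q (of_real x))"
  shows "((\<Sum>i<\<beta>. (p i)\<^sup>2) * L)-lipschitz_on {0..1::real} (\<lambda>x. poly (transfer_poly \<beta> p q) (of_real x))"
proof (rule lipschitz_onI)
  fix x y :: real assume x: "x \<in> {0..1}" and y: "y \<in> {0..1}"
  let ?a = "\<lambda>i x. (\<Sum>j<i. p j) + p i * x"
  have "dist (poly (transfer_poly \<beta> p q) (of_real x)) (poly (transfer_poly \<beta> p q) (of_real y))
      = cmod (\<Sum>i<\<beta>. of_real (p i) * (poly q (of_real (?a i x)) - poly q (of_real (?a i y))))"
    unfolding poly_transfer_poly dist_norm by (simp add: sum_subtractf algebra_simps)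
  also have "\<dots> \<le> (\<Sum>i<\<beta>. (p i)\<^sup>2 * L * dist x y)"
  proof (intro sum_norm_le)
    fix i assume "i \<in> {..<\<beta>}"
    then have i: "i < \<beta>" by simp
    have "cmod (poly q (of_real (?a i x)) - poly q (of_real (?a i y))) \<le> L * dist (?a i x) (?a i y)"
      using lipschitz_onD[OF assms affine_unit_interval[OF i x] affine_unit_interval[OF i y]]
      by (simp add: dist_norm)
    also have "dist (?a i x) (?a i y) = p i * dist x y"
      using pos[OF i] by (simp add: dist_real_def abs_mult flip: right_diff_distrib)
    finally show "cmod (of_real (p i) * (poly q (of_real (?a i x)) - poly q (of_real (?a i y))))
        \<le> (p i)\<^sup>2 * L * dist x y"
      using pos[OF i] by (simp add: norm_mult power2_eq_square mult_left_mono mult_ac)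
  qed
  also have "\<dots> = (\<Sum>i<\<beta>. (p i)\<^sup>2) * L * dist x y"
    by (simp add: sum_distrib_right)
  finally show "dist (poly (transfer_poly \<beta> p q) (of_real x)) (poly (transfer_poly \<beta> p q) (of_real y))
      \<le> (\<Sum>i<\<beta>. (p i)\<^sup>2) * L * dist x y" .
qed (use lipschitz_on_nonneg[OF assms] in \<open>simp add: sum_nonneg\<close>)

lemma lipschitz_funpow_transfer_poly:
  assumes "L-lipschitz_on {0..1::real} (\<lambda>x. poly q (of_real x))"
  shows "((\<Sum>i<\<beta>. (p i)\<^sup>2) ^ k * L)-lipschitz_on {0..1::real}
           (\<lambda>x. poly ((transfer_poly \<beta> p ^^ k) q) (of_real x))"
proof (induction k)
  case (Suc k)
  from lipschitz_transfer_poly[OF this] show ?case by (simp add: mult.assoc)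
qed (use assms in simp)

section \<open>Integration against the Bernoulli measure\<close>

abbreviation "M0 \<equiv> point_measure {..<\<beta>} (\<lambda>i. ennreal (p i))"
abbreviation "M \<equiv> bernoulli_measure \<beta> p"
abbreviation "h \<equiv> h_fun \<beta> p"

lemma prob_space_M0: "prob_space M0"
proof
  have "emeasure M0 (space M0) = (\<Sum>i<\<beta>. ennreal (p i))"
    by (simp add: space_point_measure emeasure_point_measure_finite)
  also have "\<dots> = ennreal (\<Sum>i<\<beta>. p i)"
    by (intro sum_ennreal) (simp add: less_imp_le pos)
  finally show "emeasure M0 (space M0) = 1" by (simp add: sum_one)
qed

text \<open>Makes the facts on infinite powers of one probability space, such as
  \<open>PiM_iter\<close>, available for \<open>M\<close> under its own name; \<open>P\<close> is
  then \<open>M\<close> as a probability space.\<close>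

sublocale sequence_space M0
  rewrites "(\<Pi>\<^sub>M i\<in>UNIV. M0) = M"
proof -
  interpret prob_space M0 by (rule prob_space_M0)
  show "sequence_space M0" by unfold_locales
qed (simp add: bernoulli_measure_def)

lemma space_M: "space M = (UNIV \<rightarrow>\<^sub>E {..<\<beta>})"
  by (simp add: bernoulli_measure_def space_PiM space_point_measure)

lemma digit_less: "\<omega> \<in> space M \<Longrightarrow> \<omega> n < \<beta>"
  by (auto simp: space_M)

lemma measurable_coordinate: "(\<lambda>\<omega>. g (\<omega> n)) \<in> borel_measurable M"
proof -
  have "(\<lambda>\<omega>. \<omega> n) \<in> measurable M M0"
    unfolding bernoulli_measure_def by (rule measurable_component_singleton) simp
  moreover have "g \<in> borel_measurable M0" by simp
  ultimately show ?thesis by (rule measurable_compose)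
qed

section \<open>The series for \<open>h\<close> and its range\<close>

lemma prod_digit_count:
  assumes "\<omega> \<in> space M"
  shows "(\<Prod>k<\<beta>. p k ^ digit_count \<omega> n k) = (\<Prod>i<n. p (\<omega> i))"
proof -
  \<comment> \<open>The positions before \<open>n\<close> are grouped by their digit, which is
    always below \<beta>.\<close>
  have "(\<Prod>i<n. p (\<omega> i)) = (\<Prod>k<\<beta>. \<Prod>i\<in>{i. i \<in> {..<n} \<and> \<omega> i = k}. p (\<omega> i))"
    using digit_less[OF assms] by (subst prod.group) auto
  also have "\<dots> = (\<Prod>k<\<beta>. p k ^ digit_count \<omega> n k)"
    by (intro prod.cong) (auto simp: digit_count_def)
  finally show ?thesis by simp
qed

text \<open>The case distinction of \<open>h_fun\<close> disappears because a digit 0 gives an empty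
  sum. The product form, unlike the digit counts, shows at once how a term changes when a digit is
  prepended.\<close>

definition h_term :: "(nat \<Rightarrow> nat) \<Rightarrow> nat \<Rightarrow> real" where
  "h_term \<omega> n = (\<Sum>j<\<omega> n. p j) * (\<Prod>i<n. p (\<omega> i))"

lemma h_eq_suminf: "\<omega> \<in> space M \<Longrightarrow> h \<omega> = (\<Sum>n. h_term \<omega> n)"
  unfolding h_fun_def h_term_def by (intro suminf_cong) (auto simp: prod_digit_count)

lemma h_term_nonneg: "\<omega> \<in> space M \<Longrightarrow> h_term \<omega> n \<ge> 0"
  unfolding h_term_def
  by (intro mult_nonneg_nonneg partial_sum_nonneg prod_nonneg)
    (auto simp: digit_less less_imp_le pos)

text \<open>The first \<open>n\<close> digits determine a nested subinterval of [0,1]: the partial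
  sum is its left end and the product its length, so their sum is at most 1. In the induction the
  bound telescopes.\<close>

lemma sum_h_term_le:
  assumes "\<omega> \<in> space M"
  shows "(\<Sum>i<n. h_term \<omega> i) \<le> 1 - (\<Prod>i<n. p (\<omega> i))"
proof (induction n)
  case (Suc n)
  have "h_term \<omega> n \<le> (1 - p (\<omega> n)) * (\<Prod>i<n. p (\<omega> i))"
    unfolding h_term_def using partial_sum_le[OF digit_less[OF assms, of n]]
    by (intro mult_right_mono prod_nonneg) (auto simp: digit_less[OF assms] less_imp_le pos)
  with Suc show ?case by (simp add: algebra_simps)
qed simp

lemma sum_h_term_le_one:
  assumes "\<omega> \<in> space M"
  shows "(\<Sum>i<n. h_term \<omega> i) \<le> 1"
  using sum_h_term_le[OF assms, of n] prod_pos[of "{..<n}" "\<lambda>i. p (\<omega> i)"]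
  by (simp add: digit_less[OF assms] pos)

lemma summable_h_term: "\<omega> \<in> space M \<Longrightarrow> summable (h_term \<omega>)"
  by (rule bounded_imp_summable[where B = 1])
    (simp_all add: h_term_nonneg sum_h_term_le_one del: sum.lessThan_Suc flip: lessThan_Suc_atMost)

lemma h_in_unit_interval:
  assumes "\<omega> \<in> space M"
  shows "h \<omega> \<in> {0..1}"
  using assms
  by (auto simp: h_eq_suminf summable_h_term h_term_nonneg sum_h_term_le_one
      intro!: suminf_nonneg suminf_le_const)

lemma h_measurable [measurable]: "h \<in> borel_measurable M"
proof -
  have [measurable]: "(\<lambda>\<omega>. h_term \<omega> n) \<in> borel_measurable M" for n
    unfolding h_term_def
    by (intro borel_measurable_times borel_measurable_prod measurable_coordinate)
  have "(\<lambda>\<omega>. \<Sum>n. h_term \<omega> n) \<in> borel_measurable M" by measurable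
  then show ?thesis by (simp cong: measurable_cong add: h_eq_suminf)
qed

section \<open>Prepending a digit and shifting\<close>

lemma case_nat_in_space: "\<omega> \<in> space M \<Longrightarrow> i < \<beta> \<Longrightarrow> case_nat i \<omega> \<in> space M"
  by (auto simp: space_M PiE_UNIV_domain Pi_iff split: nat.split)

lemma h_case_nat:
  assumes "\<omega> \<in> space M" "i < \<beta>"
  shows "h (case_nat i \<omega>) = (\<Sum>j<i. p j) + p i * h \<omega>"
proof -
  have s: "case_nat i \<omega> \<in> space M" by (rule case_nat_in_space[OF assms])
  \<comment> \<open>The new first digit contributes one factor to the product in every later
    term.\<close>
  have "h_term (case_nat i \<omega>) (Suc n) = p i * h_term \<omega> n" for n
    by (simp add: h_term_def prod.lessThan_Suc_shift del: prod.lessThan_Suc)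
  moreover have "h_term (case_nat i \<omega>) 0 = (\<Sum>j<i. p j)" by (simp add: h_term_def)
  ultimately show ?thesis
    using suminf_split_head[OF summable_h_term[OF s]] suminf_mult[OF summable_h_term[OF assms(1)], of "p i"]
    by (simp add: h_eq_suminf s assms(1))
qed

lemma seq_shift_case_nat: "seq_shift (case_nat i \<omega>) = \<omega>"
  by (simp add: seq_shift_def)

lemma measurable_cons: "(\<lambda>(i, \<omega>). case_nat i \<omega>) \<in> measurable (M0 \<Otimes>\<^sub>M M) M"
  unfolding bernoulli_measure_def by measurable

text \<open>By \<open>PiM_iter\<close>, \<open>M\<close> is the image of the product of
  \<open>M0\<close> and \<open>M\<close> under prepending a digit. Fubini applies, and the outer
  integral over the finite space \<open>M0\<close> is a weighted sum.\<close>

lemma integral_bernoulli_cons: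
  fixes g :: "(nat \<Rightarrow> nat) \<Rightarrow> 'b :: {banach, second_countable_topology}"
  assumes "integrable M g"
  shows "(\<integral>\<omega>. g \<omega> \<partial>M) = (\<Sum>i<\<beta>. p i *\<^sub>R (\<integral>\<omega>. g (case_nat i \<omega>) \<partial>M))"
proof -
  interpret Q: pair_prob_space M0 M ..
  let ?c = "\<lambda>(i, \<omega>). case_nat i \<omega>"
  have g: "g \<in> borel_measurable M" using assms by auto
  have int: "integrable (M0 \<Otimes>\<^sub>M M) (\<lambda>x. g (?c x))"
    using assms integrable_distr_eq[OF measurable_cons g] by (simp add: PiM_iter)
  have "(\<integral>\<omega>. g \<omega> \<partial>M) = (\<integral>x. g (?c x) \<partial>(M0 \<Otimes>\<^sub>M M))"
    using integral_distr[OF measurable_cons g] by (simp add: PiM_iter)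
  also have "\<dots> = (\<integral>i. (\<integral>\<omega>. g (case_nat i \<omega>) \<partial>M) \<partial>M0)"
    using Q.integral_fst'[OF int] by simp
  also have "\<dots> = (\<Sum>i<\<beta>. p i *\<^sub>R (\<integral>\<omega>. g (case_nat i \<omega>) \<partial>M))"
    by (intro lebesgue_integral_point_measure_finite) (auto simp: less_imp_le pos)
  finally show ?thesis .
qed

lemma measurable_seq_shift: "seq_shift \<in> measurable M M"
  unfolding seq_shift_def bernoulli_measure_def
  by (rule measurable_PiM_single')
    (auto simp: space_PiM PiE_UNIV_domain simp del: measurable_point_measure_eq2_finite
      intro!: measurable_component_singleton)

text \<open>Shift invariance: the coordinates picked out by the injection \<open>Suc\<close> again
  have the product law.\<close>

lemma distr_seq_shift: "distr M M seq_shift = M"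
  using distr_PiM_reindex[of UNIV "\<lambda>_. M0" Suc UNIV] prob_space_M0
  by (simp add: bernoulli_measure_def seq_shift_def[abs_def] restrict_UNIV)

section \<open>The Koopman operator and its adjoint on polynomials in \<open>h\<close>\<close>

lemma sq_integrable_poly_h: "(\<lambda>\<omega>. poly q (of_real (h \<omega>))) \<in> sq_integrable M"
proof -
  obtain B where B: "\<And>x. x \<in> {0..1::real} \<Longrightarrow> cmod (poly q (of_real x)) \<le> B"
    using poly_bounded_unit_interval[of q] by blast
  have m: "(\<lambda>\<omega>. poly q (of_real (h \<omega>))) \<in> borel_measurable M"
    by (rule borel_measurable_continuous_on[OF _ h_measurable]) (intro continuous_intros)
  have "AE \<omega> in M. norm ((cmod (poly q (of_real (h \<omega>))))\<^sup>2) \<le> B\<^sup>2"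
    using h_in_unit_interval by (intro AE_I2) (auto intro!: power_mono B)
  then show ?thesis
    unfolding sq_integrable_def using m by (auto intro!: P.integrable_const_bound)
qed

lemma sq_integrable_comp_shift:
  assumes "f \<in> sq_integrable M"
  shows "(\<lambda>\<omega>. f (seq_shift \<omega>)) \<in> sq_integrable M"
proof -
  have f: "f \<in> borel_measurable M" "integrable M (\<lambda>\<omega>. (cmod (f \<omega>))\<^sup>2)"
    using assms by (auto simp: sq_integrable_def)
  have "(\<lambda>\<omega>. f (seq_shift \<omega>)) \<in> borel_measurable M"
    using measurable_seq_shift f(1) by (rule measurable_compose)
  moreover have "integrable M (\<lambda>\<omega>. (cmod (f (seq_shift \<omega>)))\<^sup>2)"
    using f by (subst (asm) distr_seq_shift[symmetric])
      (simp add: integrable_distr_eq measurable_seq_shift)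
  ultimately show ?thesis by (simp add: sq_integrable_def)
qed

text \<open>The representative chosen in \<open>koopman\<close> does not matter, because the
  measure-preserving shift pulls null sets back to null sets.\<close>

lemma koopman_class:
  assumes "f \<in> sq_integrable M"
  shows "koopman M seq_shift (l2_class M f) = l2_class M (\<lambda>\<omega>. f (seq_shift \<omega>))"
  unfolding koopman_def
proof (rule l2_class_eqI)
  have "AE \<omega> in distr M M seq_shift. l2_rep (l2_class M f) \<omega> = f \<omega>"
    using l2_rep_class(2)[OF assms] unfolding distr_seq_shift .
  then show "AE \<omega> in M. l2_rep (l2_class M f) (seq_shift \<omega>) = f (seq_shift \<omega>)"
    by (rule AE_distrD[OF measurable_seq_shift])
qed (use assms in \<open>auto intro!: sq_integrable_comp_shift l2_rep_class\<close>)

text \<open>This is the adjoint identity. After splitting off the first digit, the shift removes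
  that digit again, so the factor \<open>f\<close> is the same in every branch, while
  \<open>h\<close> is replaced by its affine image. The real weights pass through the
  conjugation.\<close>

lemma integral_shift_mult_poly_h:
  assumes f: "f \<in> sq_integrable M"
  shows "(\<integral>\<omega>. f (seq_shift \<omega>) * cnj (poly q (of_real (h \<omega>))) \<partial>M) =
         (\<integral>\<omega>. f \<omega> * cnj (poly (transfer_poly \<beta> p q) (of_real (h \<omega>))) \<partial>M)"
proof -
  let ?a = "\<lambda>i \<omega>. complex_of_real ((\<Sum>j<i. p j) + p i * h \<omega>)"
  \<comment> \<open>A polynomial in an affine image of \<open>h\<close> is again a polynomial in
    \<open>h\<close>. Integrability of each branch allows the finite sum to move under the
    integral.\<close>
  have int: "integrable M (\<lambda>\<omega>. f \<omega> * cnj (poly q (?a i \<omega>)))" for i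
    using sq_integrable_imp_integrable_mult_cnj[OF f
        sq_integrable_poly_h[of "q \<circ>\<^sub>p [:of_real (\<Sum>j<i. p j), of_real (p i):]"]]
    by (simp add: poly_pcompose mult.commute)
  have "(\<integral>\<omega>. f (seq_shift \<omega>) * cnj (poly q (of_real (h \<omega>))) \<partial>M)
      = (\<Sum>i<\<beta>. p i *\<^sub>R (\<integral>\<omega>. f \<omega> * cnj (poly q (of_real (h (case_nat i \<omega>)))) \<partial>M))"
    using integral_bernoulli_cons[OF sq_integrable_imp_integrable_mult_cnj
        [OF sq_integrable_comp_shift[OF f] sq_integrable_poly_h[of q]]]
    by (simp add: seq_shift_case_nat)
  also have "\<dots> = (\<Sum>i<\<beta>. p i *\<^sub>R (\<integral>\<omega>. f \<omega> * cnj (poly q (?a i \<omega>)) \<partial>M))"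
    by (intro sum.cong refl arg_cong2[where f = scaleR] Bochner_Integration.integral_cong)
      (simp_all add: h_case_nat)
  also have "\<dots> = (\<integral>\<omega>. (\<Sum>i<\<beta>. p i *\<^sub>R (f \<omega> * cnj (poly q (?a i \<omega>)))) \<partial>M)"
    using int by simp
  also have "\<dots> = (\<integral>\<omega>. f \<omega> * cnj (poly (transfer_poly \<beta> p q) (of_real (h \<omega>))) \<partial>M)"
    unfolding poly_transfer_poly
    by (intro Bochner_Integration.integral_cong refl)
      (simp add: sum_distrib_left scaleR_conv_of_real mult_ac)
  finally show ?thesis .
qed

text \<open>The adjoint identity for the constant function 1, written as the polynomial
  \<open>1\<close> in \<open>h\<close>, with the conjugations removed.\<close>

lemma integral_transfer_poly_h:
  "(\<integral>\<omega>. poly (transfer_poly \<beta> p q) (of_real (h \<omega>)) \<partial>M) = (\<integral>\<omega>. poly q (of_real (h \<omega>)) \<partial>M)"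
  using integral_shift_mult_poly_h[OF sq_integrable_poly_h[of 1], of q] by simp

lemma integral_funpow_transfer_poly_h:
  "(\<integral>\<omega>. poly ((transfer_poly \<beta> p ^^ k) q) (of_real (h \<omega>)) \<partial>M) = (\<integral>\<omega>. poly q (of_real (h \<omega>)) \<partial>M)"
  by (induction k) (simp_all add: integral_transfer_poly_h)

section \<open>Convergence in the space of polynomials in \<open>h\<close>\<close>

text \<open>Parametrizing the space by formal polynomials makes degrees and polynomial arithmetic
  available for classes of functions.\<close>

definition h_class :: "complex poly \<Rightarrow> ((nat \<Rightarrow> nat) \<Rightarrow> complex) set" where
  "h_class q = l2_class M (\<lambda>\<omega>. poly q (of_real (h \<omega>)))"

lemma perron_frobenius_h_class:
  "perron_frobenius M seq_shift (h_class q) = h_class (transfer_poly \<beta> p q)"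
  unfolding perron_frobenius_def h_class_def
proof (rule l2_adjoint_eqI)
  fix F assume "F \<in> L2_space M"
  then obtain f where f: "f \<in> sq_integrable M" "F = l2_class M f" by (rule L2_spaceE)
  then show "l2_inner M (koopman M seq_shift F) (l2_class M (\<lambda>\<omega>. poly q (of_real (h \<omega>))))
      = l2_inner M F (l2_class M (\<lambda>\<omega>. poly (transfer_poly \<beta> p q) (of_real (h \<omega>))))"
    by (simp add: koopman_class l2_inner_class sq_integrable_comp_shift sq_integrable_poly_h
        integral_shift_mult_poly_h)
qed (intro l2_class_in_L2_space sq_integrable_poly_h)

lemma funpow_perron_frobenius_h_class:
  "(perron_frobenius M seq_shift ^^ k) (h_class q) = h_class ((transfer_poly \<beta> p ^^ k) q)"
  by (induction k) (simp_all add: perron_frobenius_h_class)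

lemma l2_add_h_class: "l2_add M (h_class q) (h_class r) = h_class (q + r)"
  by (simp add: h_class_def l2_add_class sq_integrable_poly_h)

lemma l2_scale_h_class: "l2_scale M c (h_class q) = h_class (smult c q)"
  by (simp add: h_class_def l2_scale_class sq_integrable_poly_h)

lemma h_poly_deg_eq: "h_poly_deg \<beta> p n = {h_class q | q. degree q \<le> n}"
proof (intro equalityI subsetI)
  fix F assume "F \<in> h_poly_deg \<beta> p n"
  then obtain c where F: "F = l2_class M (\<lambda>\<omega>. \<Sum>i\<le>n. c i * of_real (h \<omega>) ^ i)"
    by (auto simp: h_poly_deg_def)
  have "F = h_class (\<Sum>i\<le>n. monom (c i) i)"
    by (simp add: F h_class_def poly_sum poly_monom)
  moreover have "degree (\<Sum>i\<le>n. monom (c i) i) \<le> n"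
    by (intro degree_sum_le) (auto intro: order.trans[OF degree_monom_le])
  ultimately show "F \<in> {h_class q | q. degree q \<le> n}" by blast
next
  fix F assume "F \<in> {h_class q | q. degree q \<le> n}"
  then obtain q where q: "F = h_class q" "degree q \<le> n" by blast
  have "poly q x = (\<Sum>i\<le>n. coeff q i * x ^ i)" for x
    unfolding poly_altdef using q(2) by (intro sum.mono_neutral_left) (auto simp: coeff_eq_0)
  then show "F \<in> h_poly_deg \<beta> p n"
    unfolding h_poly_deg_def q(1) h_class_def by auto
qed

lemma h_poly_eq: "h_poly \<beta> p = range h_class"
  unfolding h_poly_def h_poly_deg_eq by blast

text \<open>The whole space is itself a basic neighbourhood of zero and closed under addition, hence
  open. Convergence in the sense of \<open>limitin\<close> requires the limit to lie in this
  set.\<close>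

lemma topspace_h_poly_topology: "topspace (h_poly_topology \<beta> p) = h_poly \<beta> p"
proof -
  have "ind_limit_nhd0 M (h_poly_deg \<beta> p) (h_poly \<beta> p)"
    unfolding ind_limit_nhd0_def
  proof (intro conjI allI)
    show "l2_abs_convex M (h_poly \<beta> p)"
      by (auto simp: l2_abs_convex_def h_poly_eq l2_add_h_class l2_scale_h_class)
    show "\<exists>\<epsilon>>0. \<forall>F\<in>h_poly_deg \<beta> p n. l2_norm M F < \<epsilon> \<longrightarrow> F \<in> h_poly \<beta> p" for n
      by (intro exI[of _ 1]) (auto simp: h_poly_def)
  qed (simp add: h_poly_def)
  moreover have "\<forall>G\<in>h_poly \<beta> p. l2_add M F G \<in> h_poly \<beta> p" if "F \<in> h_poly \<beta> p" for F
    using that by (auto simp: h_poly_eq l2_add_h_class)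
  ultimately have "ind_limit_open M (h_poly_deg \<beta> p) (h_poly \<beta> p)"
    unfolding ind_limit_open_def by (subst (1) h_poly_def[symmetric]) blast
  moreover have "U \<subseteq> h_poly \<beta> p" if "ind_limit_open M (h_poly_deg \<beta> p) U" for U
    using that by (simp add: ind_limit_open_def h_poly_def)
  ultimately show ?thesis
    unfolding topspace_def h_poly_topology_def openin_ind_limit_topology by blast
qed

text \<open>
  Only convergence in norm inside one \<open>X\<^sub>n\<close> matters: a basic neighbourhood of zero meets
  each \<open>X\<^sub>n\<close> in a neighbourhood of zero.
\<close>

lemma limitin_h_poly_topologyI:
  assumes deg: "\<And>k. degree (r k) \<le> n"
    and lim: "(\<lambda>k. l2_norm M (h_class (r k - q))) \<longlonglongrightarrow> 0"
    and "degree q \<le> n"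
  shows "limitin (h_poly_topology \<beta> p) (\<lambda>k. h_class (r k)) (h_class q) sequentially"
  unfolding limitin_def
proof (intro conjI allI impI)
  show "h_class q \<in> topspace (h_poly_topology \<beta> p)"
    by (simp add: topspace_h_poly_topology h_poly_eq)
next
  fix U assume "openin (h_poly_topology \<beta> p) U \<and> h_class q \<in> U"
  then have "ind_limit_open M (h_poly_deg \<beta> p) U" "h_class q \<in> U"
    by (simp_all add: h_poly_topology_def openin_ind_limit_topology)
  then obtain W where W: "ind_limit_nhd0 M (h_poly_deg \<beta> p) W" "\<forall>G\<in>W. l2_add M (h_class q) G \<in> U"
    by (rule ind_limit_openE)
  from W(1) obtain \<epsilon> where \<epsilon>: "\<epsilon> > 0"
    "\<And>F. F \<in> h_poly_deg \<beta> p n \<Longrightarrow> l2_norm M F < \<epsilon> \<Longrightarrow> F \<in> W"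
    unfolding ind_limit_nhd0_def by meson
  have "h_class (r k - q) \<in> h_poly_deg \<beta> p n" for k
    using degree_diff_le[OF deg assms(3)] by (auto simp: h_poly_deg_eq)
  moreover have "\<forall>\<^sub>F k in sequentially. l2_norm M (h_class (r k - q)) < \<epsilon>"
    using order_tendstoD(2)[OF lim \<epsilon>(1)] .
  ultimately have "\<forall>\<^sub>F k in sequentially. h_class (r k - q) \<in> W"
    by (auto elim!: eventually_mono intro: \<epsilon>(2))
  then show "\<forall>\<^sub>F k in sequentially. h_class (r k) \<in> U"
  proof eventually_elim
    case (elim k)
    with W(2) have "l2_add M (h_class q) (h_class (r k - q)) \<in> U" by blast
    then show ?case by (simp add: l2_add_h_class)
  qed
qed

text \<open>The deviation from the mean is the average over \<eta> of
  \<open>q(h \<omega>) - q(h \<eta>)\<close>, and two values of \<open>h\<close> are at distance at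
  most 1.\<close>

lemma poly_h_minus_integral_le:
  assumes L: "L-lipschitz_on {0..1::real} (\<lambda>x. poly q (of_real x))" and \<omega>: "\<omega> \<in> space M"
  shows "cmod (poly q (of_real (h \<omega>)) - (\<integral>\<eta>. poly q (of_real (h \<eta>)) \<partial>M)) \<le> L"
proof -
  let ?g = "\<lambda>\<eta>. poly q (of_real (h \<omega>)) - poly q (of_real (h \<eta>))"
  \<comment> \<open>Obtained as the product of two square-integrable functions, the second being the
    constant 1.\<close>
  have int: "integrable M (\<lambda>\<eta>. poly q (of_real (h \<eta>)))"
    using sq_integrable_imp_integrable_mult_cnj[OF sq_integrable_poly_h[of q] sq_integrable_poly_h[of 1]]
    by simp
  have le: "cmod (?g \<eta>) \<le> L" if "\<eta> \<in> space M" for \<eta>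
  proof -
    have h: "h \<omega> \<in> {0..1}" "h \<eta> \<in> {0..1}" using \<omega> that by (auto intro: h_in_unit_interval simp del: atLeastAtMost_iff)
    have "cmod (?g \<eta>) \<le> L * dist (h \<omega>) (h \<eta>)"
      using lipschitz_onD[OF L h] by (simp add: dist_norm)
    also have "\<dots> \<le> L * 1"
      using h lipschitz_on_nonneg[OF L] by (intro mult_left_mono) (auto simp: dist_real_def)
    finally show ?thesis by simp
  qed
  have "poly q (of_real (h \<omega>)) - (\<integral>\<eta>. poly q (of_real (h \<eta>)) \<partial>M) = (\<integral>\<eta>. ?g \<eta> \<partial>M)"
    using int by (simp add: P.prob_space)
  also have "cmod \<dots> \<le> (\<integral>\<eta>. cmod (?g \<eta>) \<partial>M)" by (rule integral_norm_bound)
  also have "\<dots> \<le> L" using int le by (intro P.integral_le_const) (auto intro!: AE_I2)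
  finally show ?thesis .
qed

text \<open>On a probability space the sup norm dominates the \<open>L2\<close> norm.\<close>

lemma l2_norm_h_class_le:
  assumes "\<And>\<omega>. \<omega> \<in> space M \<Longrightarrow> cmod (poly q (of_real (h \<omega>))) \<le> B" "B \<ge> 0"
  shows "l2_norm M (h_class q) \<le> B"
proof -
  have "(\<integral>\<omega>. (cmod (poly q (of_real (h \<omega>))))\<^sup>2 \<partial>M) \<le> B\<^sup>2"
    using sq_integrable_poly_h[of q] assms(1)
    by (intro P.integral_le_const) (auto simp: sq_integrable_def intro!: AE_I2 power_mono)
  then have "sqrt (\<integral>\<omega>. (cmod (poly q (of_real (h \<omega>))))\<^sup>2 \<partial>M) \<le> sqrt (B\<^sup>2)"
    by (rule real_sqrt_le_mono)
  then show ?thesis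
    using assms(2) by (simp add: h_class_def l2_norm_class sq_integrable_poly_h)
qed

lemma limitin_perron_frobenius_h_class:
  "limitin (h_poly_topology \<beta> p) (\<lambda>k. (perron_frobenius M seq_shift ^^ k) (h_class q))
     (h_class [:\<integral>\<omega>. poly q (of_real (h \<omega>)) \<partial>M:]) sequentially"
  unfolding funpow_perron_frobenius_h_class
\<comment> \<open>All iterates and the constant limit have degree at most
  \<open>degree q\<close>.\<close>
proof (rule limitin_h_poly_topologyI[where n = "degree q"])
  let ?c = "\<integral>\<omega>. poly q (of_real (h \<omega>)) \<partial>M"
  let ?r = "\<lambda>k. (transfer_poly \<beta> p ^^ k) q"
  let ?\<rho> = "\<Sum>i<\<beta>. (p i)\<^sup>2"
  obtain L where L: "L \<ge> 0" "L-lipschitz_on {0..1::real} (\<lambda>x. poly q (of_real x))"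
    using poly_lipschitz_unit_interval by blast
  have \<rho>: "?\<rho> \<ge> 0" by (simp add: sum_nonneg)
  have upper: "l2_norm M (h_class (?r k - [:?c:])) \<le> ?\<rho> ^ k * L" for k
  proof (rule l2_norm_h_class_le)
    show "cmod (poly (?r k - [:?c:]) (of_real (h \<omega>))) \<le> ?\<rho> ^ k * L" if "\<omega> \<in> space M" for \<omega>
      \<comment> \<open>The mean of the \<open>k\<close>-th iterate is the mean of \<open>q\<close>,
        so the same constant \<open>?c\<close> serves for all \<open>k\<close>.\<close>
      using poly_h_minus_integral_le[OF lipschitz_funpow_transfer_poly[OF L(2), of k] that]
      unfolding integral_funpow_transfer_poly_h by simp
  qed (use L(1) \<rho> in simp)
  have lower: "0 \<le> l2_norm M F" for F
    by (simp add: l2_norm_def)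
  have "(\<lambda>k. ?\<rho> ^ k * L) \<longlonglongrightarrow> 0"
    using \<rho> sum_squares_less_one by (intro tendsto_mult_left_zero LIMSEQ_power_zero) simp
  then show "(\<lambda>k. l2_norm M (h_class (?r k - [:?c:]))) \<longlonglongrightarrow> 0"
    by (rule tendsto_sandwich[OF _ _ tendsto_const, rotated 2])
      (simp_all only: upper lower eventually_True)
qed (simp_all add: degree_funpow_transfer_poly_le)

end

theorem corollary3p13:
  fixes \<beta> :: nat and p :: "nat \<Rightarrow> real" and f :: "((nat \<Rightarrow> nat) \<Rightarrow> complex) set"
  assumes "\<beta> \<ge> 2"
    and "\<forall>i<\<beta>. p i > 0"
    and "(\<Sum>i<\<beta>. p i) = 1"
    and "f \<in> h_poly \<beta> p"
  shows "limitin (h_poly_topology \<beta> p)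
           (\<lambda>k. (perron_frobenius (bernoulli_measure \<beta> p) seq_shift ^^ k) f)
           (l2_scale (bernoulli_measure \<beta> p) (l2_integral (bernoulli_measure \<beta> p) f)
              (l2_class (bernoulli_measure \<beta> p) (\<lambda>_. 1)))
           sequentially"
proof -
  interpret probability_weights \<beta> p
    using assms by unfold_locales auto
  obtain q where f: "f = h_class q"
    using assms(4) by (auto simp: h_poly_eq)
  have "l2_class M (\<lambda>_. 1) = h_class 1"
    by (simp add: h_class_def)
  \<comment> \<open>Scaling the polynomial \<open>1\<close> by the integral gives the constant
    polynomial that is the limit found above.\<close>
  then have "l2_scale M (l2_integral M f) (l2_class M (\<lambda>_. 1))
      = h_class [:\<integral>\<omega>. poly q (of_real (h \<omega>)) \<partial>M:]"
    by (simp add: l2_scale_h_class f h_class_def[of q] l2_integral_class sq_integrable_poly_h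
        one_pCons)
  then show ?thesis
    using limitin_perron_frobenius_h_class[of q] by (simp add: f)
qed

end
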